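(* Let $\mathbf T=\mathrm{diag}\{1,\mathbf T_3,\mathbf T_3,1\}\in\mathbb R^{8\times 8}$ (block diagonal), where $\mathbf T_3$ is any orthogonal matrix of size $3$. If $\mathbf U\in\mathcal G_1$, then $\mathbf T\mathbf U\in\mathcal G_1$.
   Context: $\mathcal G_1$ is the (equivalent form of the) admissible state set $$\mathcal G_1=\Big\{\mathbf U=(D,\mathbf m,\mathbf B,E)^\top\in\mathbb R^8\ \Big|\ D>0,\ \ \mathbf U\cdot\mathbf n^*+p_m^*>0\ \text{ for all } \mathbf B^*,\mathbf v^*\in\mathbb R^3\text{ with }|\mathbf v^*|<1\Big\},$$ with $D,E\in\mathbb R$, $\mathbf m,\mathbf B\in\mathbb R^3$, and $$\mathbf n^*=\Big(-\sqrt{1-|\mathbf v^*|^2},\ -\mathbf v^*,\ -(1-|\mathbf v^*|^2)\mathbf B^*-(\mathbf v^*\cdot\mathbf B^* )\mathbf v^*,\ 1\Big)^\top,\qquad p_m^*=\frac{(1-|\mathbf v^*|^2)|\mathbf B^*|^2+(\mathbf v^*\cdot\mathbf B^* )^2}{2}.$$ *)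

theory Defs
  imports "HOL-Analysis.Analysis"
begin

text \<open>
  The state space is \<open>real ^ 8\<close>, with components numbered 1 to 8 (in the index type \<open>8\<close>
  the numeral 8 is equal to 0, so 1, ..., 8 are exactly its eight elements).
  Primed variables \<open>B'\<close>, \<open>v'\<close> are the auxiliary starred vectors; they are
  unrelated to the fields contained in the state.
\<close>

definition state :: "real \<Rightarrow> real ^ 3 \<Rightarrow> real ^ 3 \<Rightarrow> real \<Rightarrow> real ^ 8" where
  "state D m B E = vector [D, m $ 1, m $ 2, m $ 3, B $ 1, B $ 2, B $ 3, E]"

definition n_star :: "real ^ 3 \<Rightarrow> real ^ 3 \<Rightarrow> real ^ 8" where
  "n_star B' v' =
     state (- sqrt (1 - (norm v')\<^sup>2))
           (- v')
           (- ((1 - (norm v')\<^sup>2) *\<^sub>R B') - (v' \<bullet> B') *\<^sub>R v')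
           1"

definition pm_star :: "real ^ 3 \<Rightarrow> real ^ 3 \<Rightarrow> real" where
  "pm_star B' v' = ((1 - (norm v')\<^sup>2) * (norm B')\<^sup>2 + (v' \<bullet> B')\<^sup>2) / 2"

definition G1 :: "(real ^ 8) set" where
  "G1 = {U. \<exists>D m B E. U = state D m B E \<and> D > 0 \<and>
            (\<forall>B' v'. norm v' < 1 \<longrightarrow> U \<bullet> n_star B' v' + pm_star B' v' > 0)}"

text \<open>\<open>diag {1, Q, Q, 1}\<close>; the inner vectors are the rows, matching the convention of \<open>*v\<close>.\<close>

definition block_diag :: "real ^ 3 ^ 3 \<Rightarrow> real ^ 8 ^ 8" where
  "block_diag Q = vector
    [vector [1, 0, 0, 0, 0, 0, 0, 0],
     vector [0, Q $ 1 $ 1, Q $ 1 $ 2, Q $ 1 $ 3, 0, 0, 0, 0],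
     vector [0, Q $ 2 $ 1, Q $ 2 $ 2, Q $ 2 $ 3, 0, 0, 0, 0],
     vector [0, Q $ 3 $ 1, Q $ 3 $ 2, Q $ 3 $ 3, 0, 0, 0, 0],
     vector [0, 0, 0, 0, Q $ 1 $ 1, Q $ 1 $ 2, Q $ 1 $ 3, 0],
     vector [0, 0, 0, 0, Q $ 2 $ 1, Q $ 2 $ 2, Q $ 2 $ 3, 0],
     vector [0, 0, 0, 0, Q $ 3 $ 1, Q $ 3 $ 2, Q $ 3 $ 3, 0],
     vector [0, 0, 0, 0, 0, 0, 0, 1]]"

end

theory Submission
  imports Defs
begin

text \<open>
  The function \<open>(U, B', v') \<mapsto> U \<bullet> n_star B' v' + pm_star B' v'\<close> is built from Euclidean inner
  products of the momentum, the magnetic field, \<open>B'\<close> and \<open>v'\<close>, and from scalars. It is therefore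
  unchanged when one orthogonal matrix \<open>Q\<close> is applied to all four vectors
  (\<open>n_star_orthogonal\<close>, \<open>pm_star_orthogonal\<close> and \<open>inner_block_diag\<close>). The constraint that
  \<open>block_diag Q *v U\<close> has to satisfy for \<open>(Q *v B', Q *v v')\<close> is thus the constraint that \<open>U\<close>
  satisfies for \<open>(B', v')\<close>. Since \<open>Q\<close> maps the space onto itself and preserves the norm, every
  pair \<open>(B', v')\<close> with \<open>norm v' < 1\<close> is the image of another such pair, so that no constraint is
  left out; and the sign of \<open>D\<close> is not affected.
\<close>

lemma exhaust_8:
  fixes x :: 8
  shows "x = 1 \<or> x = 2 \<or> x = 3 \<or> x = 4 \<or> x = 5 \<or> x = 6 \<or> x = 7 \<or> x = 8"
proof (induct x)
  case (of_int z)
  then have "0 \<le> z" and "z < 8" by simp_all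
  \<comment> \<open>The representative \<open>z = 0\<close> is the element \<open>8\<close>, because \<open>8 = 0\<close> in this type.\<close>
  then have "z = 0 \<or> z = 1 \<or> z = 2 \<or> z = 3 \<or> z = 4 \<or> z = 5 \<or> z = 6 \<or> z = 7" by arith
  then show ?case by auto
qed

lemma forall_8: "(\<forall>i::8. P i) \<longleftrightarrow> P 1 \<and> P 2 \<and> P 3 \<and> P 4 \<and> P 5 \<and> P 6 \<and> P 7 \<and> P 8"
  by (metis exhaust_8)

lemma UNIV_8: "UNIV = {1::8, 2, 3, 4, 5, 6, 7, 8}"
  using exhaust_8 by auto

lemma sum_8: "sum f (UNIV::8 set) = f 1 + f 2 + f 3 + f 4 + f 5 + f 6 + f 7 + f 8"
  unfolding UNIV_8 by (simp add: ac_simps)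

lemma vector_8:
  "(vector [a,b,c,d,e,f,g,h] :: 'a::zero ^ 8) $ 1 = a"
  "(vector [a,b,c,d,e,f,g,h] :: 'a::zero ^ 8) $ 2 = b"
  "(vector [a,b,c,d,e,f,g,h] :: 'a::zero ^ 8) $ 3 = c"
  "(vector [a,b,c,d,e,f,g,h] :: 'a::zero ^ 8) $ 4 = d"
  "(vector [a,b,c,d,e,f,g,h] :: 'a::zero ^ 8) $ 5 = e"
  "(vector [a,b,c,d,e,f,g,h] :: 'a::zero ^ 8) $ 6 = f"
  "(vector [a,b,c,d,e,f,g,h] :: 'a::zero ^ 8) $ 7 = g"
  "(vector [a,b,c,d,e,f,g,h] :: 'a::zero ^ 8) $ 8 = h"
  unfolding vector_def by simp_all

lemma inner_state:
  "state D m B E \<bullet> state D' m' B' E' = D * D' + m \<bullet> m' + B \<bullet> B' + E * E'"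
  by (simp add: state_def inner_vec_def sum_8 sum_3 vector_8)

lemma block_diag_mult_state:
  "block_diag Q *v state D m B E = state D (Q *v m) (Q *v B) E"
  by (simp add: vec_eq_iff forall_8 block_diag_def state_def matrix_vector_mult_def
      sum_8 sum_3 vector_8)

lemma inner_orthogonal_matrix:
  fixes Q :: "real ^ 'n ^ 'n"
  assumes "orthogonal_matrix Q"
  shows "(Q *v x) \<bullet> (Q *v y) = x \<bullet> y"
proof -
  have "orthogonal_transformation ((*v) Q)"
    using assms by (simp add: orthogonal_transformation_matrix)
  then show ?thesis
    by (simp add: orthogonal_transformation_def)
qed

lemma norm_orthogonal_matrix:
  fixes Q :: "real ^ 'n ^ 'n"
  assumes "orthogonal_matrix Q"
  shows "norm (Q *v x) = norm x"
  by (simp add: norm_eq_sqrt_inner inner_orthogonal_matrix[OF assms])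

lemma orthogonal_matrix_mult_transpose:
  fixes Q :: "real ^ 'n ^ 'n"
  assumes "orthogonal_matrix Q"
  shows "Q *v (transpose Q *v x) = x"
  using assms
  by (simp add: orthogonal_matrix_def matrix_vector_mul_assoc del: transpose_matrix_vector)

text \<open>
  The hypothesis on \<open>Q\<close> makes \<open>block_diag Q\<close> an isometry of the state space. Both arguments are
  written with \<open>state\<close> because its inner product splits into those of the blocks.
\<close>

lemma inner_block_diag:
  assumes "orthogonal_matrix Q"
  shows "(block_diag Q *v state D m B E) \<bullet> (block_diag Q *v state D' m' B' E')
    = state D m B E \<bullet> state D' m' B' E'"
  by (simp add: block_diag_mult_state inner_state inner_orthogonal_matrix[OF assms])

text \<open>
  The coefficients in \<open>n_star\<close> are functions of \<open>norm v\<close> and \<open>v \<bullet> B\<close>, which \<open>Q\<close> preserves; its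
  vector blocks are linear combinations of \<open>B\<close> and \<open>v\<close> with these coefficients, and so turn with
  them.
\<close>

lemma n_star_orthogonal:
  assumes "orthogonal_matrix Q"
  shows "n_star (Q *v B) (Q *v v) = block_diag Q *v n_star B v"
proof -
  have "- (Q *v v) = Q *v (- v)"
    by (simp add: matrix_vector_mult_def vec_eq_iff sum_negf)
  moreover have "- (c *\<^sub>R (Q *v B)) - d *\<^sub>R (Q *v v) = Q *v (- (c *\<^sub>R B) - d *\<^sub>R v)" for c d
    by (simp add: matrix_vector_mult_def vec_eq_iff sum_3 algebra_simps)
  ultimately show ?thesis
    by (simp add: n_star_def block_diag_mult_state inner_orthogonal_matrix[OF assms]
        norm_orthogonal_matrix[OF assms])
qed

lemma pm_star_orthogonal:
  assumes "orthogonal_matrix Q"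
  shows "pm_star (Q *v B) (Q *v v) = pm_star B v"
  by (simp add: pm_star_def inner_orthogonal_matrix[OF assms] norm_orthogonal_matrix[OF assms])

theorem corollary2p2:
  fixes T3 :: "real ^ 3 ^ 3" and U :: "real ^ 8"
  assumes "orthogonal_matrix T3"
    and "U \<in> G1"
  shows "block_diag T3 *v U \<in> G1"
proof -
  obtain D m B E where U: "U = state D m B E" and "D > 0"
    and pos: "\<And>B' v'. norm v' < 1 \<Longrightarrow> U \<bullet> n_star B' v' + pm_star B' v' > 0"
    using assms(2) unfolding G1_def by blast
  have "(block_diag T3 *v U) \<bullet> n_star B' v' + pm_star B' v' > 0" if "norm v' < 1" for B' v'
  proof -
    \<comment> \<open>The preimage under \<open>T3\<close>: the pair whose constraint on \<open>U\<close> is the wanted one.\<close>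
    define b v where "b = transpose T3 *v B'" and "v = transpose T3 *v v'"
    have B': "B' = T3 *v b" and v': "v' = T3 *v v"
      unfolding b_def v_def by (simp_all only: orthogonal_matrix_mult_transpose[OF assms(1)])
    have "(block_diag T3 *v U) \<bullet> n_star B' v' = U \<bullet> n_star b v"
      unfolding B' v' n_star_orthogonal[OF assms(1)] unfolding U n_star_def
      by (rule inner_block_diag[OF assms(1)])
    moreover have "pm_star B' v' = pm_star b v"
      unfolding B' v' by (rule pm_star_orthogonal[OF assms(1)])
    moreover have "norm v < 1"
      using that unfolding v' by (simp add: norm_orthogonal_matrix[OF assms(1)])
    ultimately show ?thesis using pos by simp
  qed
  then show ?thesis
    using \<open>D > 0\<close> unfolding G1_def U block_diag_mult_state by blast
qed

end
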